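(* Let $n \geq 2$ be an integer, let $R$ be a tournament on $[n]$, and let $N$ be either an odd integer with $N \geq 3^{n-2}$ or an even integer with $N \geq 2 \cdot 3^{n-2}$. Then there exists an $n$ partition $\mathcal{A}$ of $[Nn]$ with $R[\mathcal{A}] = R$.
   Context: For a positive integer $m$, $[m] = \{1, \dots, m\}$, and $|X|$ is the cardinality of a finite set $X$. A digraph on a nonempty finite set $I$ is a subset $R \subset I \times I$ with $R \cap R^{-1} = \emptyset$, where $R^{-1} = \{(j,i) : (i,j) \in R\}$. A tournament on $I$ is a digraph $R$ on $I$ such that for every pair of distinct $i, j \in I$ exactly one of $(i,j), (j,i)$ lies in $R$. For positive integers $n, N$, an $n$ partition of $[Nn]$ is an indexed family $\mathcal{A} = \{A_1, \dots, A_n\}$ of pairwise disjoint subsets of $[Nn]$ with union $[Nn]$ and $|A_i| = N$ for all $i$. Its digraph on $[n]$ is $R[\mathcal{A}] = \{(i,j) \in [n] \times [n] : |\{(a,b) \in A_i \times A_j : a > b\}| > N^2/2\}$. *)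

theory Defs
  imports Complex_Main "HOL-Library.Disjoint_Sets"
begin

definition digraph_on :: "'a set \<Rightarrow> 'a rel \<Rightarrow> bool" where
  "digraph_on I R \<longleftrightarrow>
     finite I \<and> I \<noteq> {} \<and> R \<subseteq> I \<times> I \<and> R \<inter> R\<inverse> = {}"

definition tournament_on :: "'a set \<Rightarrow> 'a rel \<Rightarrow> bool" where
  "tournament_on I R \<longleftrightarrow>
     digraph_on I R \<and>
     (\<forall>i\<in>I. \<forall>j\<in>I. i \<noteq> j \<longrightarrow> ((i, j) \<in> R) \<noteq> ((j, i) \<in> R))"

(* The family is a total function of the index; only its values on {1..n} matter. *)
definition n_partition :: "nat \<Rightarrow> nat \<Rightarrow> (nat \<Rightarrow> nat set) \<Rightarrow> bool" where
  "n_partition n N A \<longleftrightarrow>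
     disjoint_family_on A {1..n} \<and>
     (\<Union>i\<in>{1..n}. A i) = {1..N * n} \<and>
     (\<forall>i\<in>{1..n}. card (A i) = N)"

(* The bound N^2/2 is taken in the reals, so there is no rounding for odd N. *)
definition partition_digraph :: "nat \<Rightarrow> nat \<Rightarrow> (nat \<Rightarrow> nat set) \<Rightarrow> nat rel" where
  "partition_digraph n N A =
     {(i, j) \<in> {1..n} \<times> {1..n}.
        real (card {(a, b) \<in> A i \<times> A j. a > b}) > (real N)\<^sup>2 / 2}"

end

(* Encode a partition of {1..N * n} as the word whose p-th letter is the index of the block
   containing p. Induct on n. Given a word w for the subtournament without z, let s be a word
   containing every vertex beaten by z exactly k times, and t one containing every vertex beating z
   exactly k times. In the word w s z^(N + 2k) t (rev t) (rev s), with w having N copies of each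
   letter, the part s t (rev t) (rev s) is balanced between any two old letters, so the majorities
   of w survive. Before the block of z's there are N + k copies of each letter of s, after it k;
   for a letter of t these numbers are N and 2k. So z relates to the old letters as prescribed as
   soon as 0 < N < 2k, and this allows the passage from N to any larger number of the same parity
   that is at least 3N. *)
theory Submission
  imports Defs
begin

text \<open>Counts the pairs of positions where an \<open>i\<close> stands to the right of a
  \<open>j\<close>; larger position wins, matching a > b in the digraph of a partition.\<close>

fun wins :: "'a \<Rightarrow> 'a \<Rightarrow> 'a list \<Rightarrow> nat" where
  "wins i j [] = 0"
| "wins i j (x # xs) = (if x = j then count_list xs i else 0) + wins i j xs"

lemma wins_append:
  "wins i j (u @ v) = wins i j u + wins i j v + count_list u j * count_list v i"
  by (induction u) (auto simp: algebra_simps)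

text \<open>Reversal exchanges left and right. Together with \<open>wins_swap\<close> this makes
  \<open>u @ rev u\<close> balanced between any two distinct letters.\<close>

lemma wins_rev: "wins i j (rev u) = wins j i u"
  by (induction u) (auto simp: wins_append)

lemma wins_swap:
  "i \<noteq> j \<Longrightarrow> wins i j u + wins j i u = count_list u i * count_list u j"
  by (induction u) (auto simp: algebra_simps)

text \<open>Ordered pairs of occurrences of \<open>i\<close> split into increasing, decreasing and
  equal ones. Hence no letter has a majority over itself.\<close>

lemma wins_self: "2 * wins i i u + count_list u i = (count_list u i)\<^sup>2"
  by (induction u) (auto simp: power2_eq_square)

lemma wins_eq_0: "i \<notin> set u \<or> j \<notin> set u \<Longrightarrow> wins i j u = 0"
  by (induction u) auto

lemma count_list_replicate: "count_list (replicate m x) y = (if x = y then m else 0)"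
  by (induction m) auto

definition positions :: "'a list \<Rightarrow> 'a \<Rightarrow> nat set" where
  "positions w i = {p \<in> {1..length w}. w ! (p - 1) = i}"

lemma finite_positions [simp]: "finite (positions w i)"
  by (simp add: positions_def)

lemma positions_Nil [simp]: "positions [] i = {}"
  by (simp add: positions_def)

lemma positions_snoc:
  "positions (w @ [x]) i = positions w i \<union> (if x = i then {Suc (length w)} else {})"
  by (auto simp: positions_def nth_append le_Suc_eq)

lemma positions_le: "p \<in> positions w i \<Longrightarrow> p \<le> length w"
  by (simp add: positions_def)

lemma card_positions: "card (positions w i) = count_list w i"
proof (induction w rule: rev_induct)
  case (snoc x w)
  have "Suc (length w) \<notin> positions w i"
    using positions_le by fastforce
  with snoc show ?case by (simp add: positions_snoc)
qed simp

lemma card_wins: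
  "card {(a, b) \<in> positions w i \<times> positions w j. a > b} = wins i j w"
proof (induction w rule: rev_induct)
  case (snoc x w)
  let ?P = "{(a, b) \<in> positions w i \<times> positions w j. a > b}"
  \<comment> \<open>The appended position exceeds all earlier ones, so it adds pairs only as the
    larger component.\<close>
  let ?Q = "(if x = i then {Suc (length w)} else {}) \<times> positions w j"
  have "{(a, b) \<in> positions (w @ [x]) i \<times> positions (w @ [x]) j. a > b} = ?P \<union> ?Q"
    by (auto simp: positions_snoc dest: positions_le split: if_splits)
  moreover have "?P \<inter> ?Q = {}"
    by (auto dest: positions_le split: if_splits)
  moreover have "finite ?P"
    by (rule finite_subset[of _ "positions w i \<times> positions w j"]) auto
  ultimately have "card {(a, b) \<in> positions (w @ [x]) i \<times> positions (w @ [x]) j. a > b}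
      = card ?P + card ?Q"
    by (simp add: card_Un_disjoint)
  also have "\<dots> = wins i j (w @ [x])"
    using snoc by (simp add: wins_append card_positions card_cartesian_product)
  finally show ?case .
qed simp

text \<open>Only the arcs of \<open>R\<close> are asked to be majorities, which suits the induction;
  doubling keeps the bound in the naturals.\<close>

definition realizes :: "'a set \<Rightarrow> 'a rel \<Rightarrow> nat \<Rightarrow> 'a list \<Rightarrow> bool" where
  "realizes I R N w \<longleftrightarrow>
     set w \<subseteq> I \<and> (\<forall>i\<in>I. count_list w i = N) \<and> (\<forall>(i, j)\<in>R. N\<^sup>2 < 2 * wins i j w)"

lemma realizes_imp_partition:
  assumes w: "realizes {1..n} R N w" and R: "tournament_on {1..n} R"
  shows "n_partition n N (positions w) \<and> partition_digraph n N (positions w) = R"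
proof
  have cnt: "count_list w i = N" if "i \<in> {1..n}" for i
    using w that by (simp add: realizes_def)
  have set_w: "set w \<subseteq> {1..n}" using w by (simp add: realizes_def)
  have len: "length w = N * n"
    using sum_count_set[OF set_w] sum.cong[OF refl cnt, of "{1..n}" "\<lambda>i. i"] by simp
  have "w ! (p - 1) \<in> {1..n}" if "p \<in> {1..length w}" for p
    using that by (intro subsetD[OF set_w] nth_mem) auto
  then have "(\<Union>i\<in>{1..n}. positions w i) = {1..N * n}"
    unfolding len[symmetric] by (fastforce simp: positions_def)
  moreover have "disjoint_family_on (positions w) {1..n}"
    by (auto simp: disjoint_family_on_def positions_def)
  ultimately show "n_partition n N (positions w)"
    by (simp add: n_partition_def card_positions cnt)
  have win: "N\<^sup>2 < 2 * wins i j w" if "(i, j) \<in> R" for i j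
    using w that by (auto simp: realizes_def)
  have "N\<^sup>2 < 2 * wins i j w \<longleftrightarrow> (i, j) \<in> R" if ij: "i \<in> {1..n}" "j \<in> {1..n}" for i j
  proof
    assume gt: "N\<^sup>2 < 2 * wins i j w"
    have "2 * wins i i w \<le> N\<^sup>2" using wins_self[of i w] unfolding cnt[OF ij(1)] by linarith
    then have "i \<noteq> j" using gt by (metis not_less)
    moreover have "(j, i) \<notin> R"
    proof
      assume "(j, i) \<in> R"
      \<comment> \<open>Both majorities together would exceed the total of \<open>N * N\<close>
        pairs given by \<open>wins_swap\<close>.\<close>
      then show False
        using gt win[of j i] wins_swap[OF \<open>i \<noteq> j\<close>, of w]
        unfolding cnt[OF ij(1)] cnt[OF ij(2)] power2_eq_square by linarith
    qed
    ultimately show "(i, j) \<in> R" using R ij unfolding tournament_on_def by blast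
  qed (rule win)
  moreover have "(real N)\<^sup>2 / 2 < real m \<longleftrightarrow> N\<^sup>2 < 2 * m" for m
  proof -
    have "(real N)\<^sup>2 / 2 < real m \<longleftrightarrow> real (N\<^sup>2) < real (2 * m)" by auto
    then show ?thesis by (simp only: of_nat_less_iff)
  qed
  moreover have "R \<subseteq> {1..n} \<times> {1..n}"
    using R by (simp add: tournament_on_def digraph_on_def)
  ultimately show "partition_digraph n N (positions w) = R"
    unfolding partition_digraph_def card_wins by auto
qed

lemma ex_word_count_list:
  assumes "finite S"
  obtains s where "\<And>i. count_list s i = (if i \<in> S then k else 0)"
proof -
  have "\<exists>s. \<forall>i. count_list s i = (if i \<in> S then k else 0)"
    using assms
  proof (induction S)
    case empty
    show ?case by (intro exI[of _ "[]"]) simp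
  next
    case (insert x S)
    then obtain s where "\<forall>i. count_list s i = (if i \<in> S then k else 0)" by blast
    with insert show ?case
      by (intro exI[of _ "replicate k x @ s"]) (auto simp: count_list_replicate)
  qed
  then show thesis using that by blast
qed

lemma realizes_insert:
  assumes I: "finite I" "z \<notin> I"
    and R: "R \<subseteq> insert z I \<times> insert z I" "R \<inter> R\<inverse> = {}"
    and w: "realizes I (R \<inter> I \<times> I) N w"
    and N: "0 < N" "N < 2 * k"
  shows "\<exists>w'. realizes (insert z I) R (N + 2 * k) w'"
proof -
  define S where "S = {i \<in> I. (z, i) \<in> R}"
  \<comment> \<open>All other old vertices go here; arcs into \<open>z\<close> start in
    \<open>T\<close> because \<open>R\<close> has no opposite arcs.\<close>
  define T where "T = I - S"
  define M where "M = N + 2 * k"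
  have "finite S" "finite T" using I by (auto simp: S_def T_def)
  then obtain s t
    where s: "\<And>i. count_list s i = (if i \<in> S then k else 0)"
      and t: "\<And>i. count_list t i = (if i \<in> T then k else 0)"
    using ex_word_count_list[of _ k] by metis
  have "set s \<subseteq> S" using s by (metis count_list_0_iff subsetI N less_nat_zero_code)
  moreover have "set t \<subseteq> T" using t by (metis count_list_0_iff subsetI N less_nat_zero_code)
  ultimately have set_st: "set s \<subseteq> I" "set t \<subseteq> I" by (auto simp: S_def T_def)
  have set_w: "set w \<subseteq> I" and cnt: "\<And>i. i \<in> I \<Longrightarrow> count_list w i = N"
    and win: "\<And>i j. (i, j) \<in> R \<inter> I \<times> I \<Longrightarrow> N\<^sup>2 < 2 * wins i j w"
    using w by (auto simp: realizes_def)
  have z: "z \<notin> set w" "z \<notin> set s" "z \<notin> set t" "z \<notin> S" "z \<notin> T"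
    using set_w set_st I by (auto simp: S_def T_def)
  have cnt_z: "count_list w z = 0" using z by simp
  define w' where "w' = w @ s @ replicate M z @ t @ rev t @ rev s"
  have "set w' \<subseteq> insert z I" using set_w set_st by (auto simp: w'_def)
  moreover have "count_list w' i = M" if "i \<in> insert z I" for i
    using that I(2) cnt z
    by (auto simp: w'_def s t cnt_z count_list_replicate M_def S_def T_def)
  moreover have "M\<^sup>2 < 2 * wins i j w'" if ij: "(i, j) \<in> R" for i j
  proof -
    have "i \<noteq> j" using R(2) ij by auto
    then consider "i \<in> I" "j \<in> I" | "i = z" "j \<in> S" | "i \<in> T" "j = z"
      using R ij by (auto simp: S_def T_def)
    then show ?thesis
    proof cases
      case 1
      have nz: "i \<noteq> z" "j \<noteq> z" using 1 I by auto
      \<comment> \<open>The \<open>N\<close> copies of \<open>j\<close> in \<open>w\<close> precede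
        2k later copies of \<open>i\<close>, giving 2Nk; the balanced part gives half of its (2k)^2
        pairs. Doubling adds 4Nk + 4k^2, exactly the growth from N^2 to M^2.\<close>
      have "wins i j w' = wins i j w + 2 * N * k + 2 * k * k"
        using wins_swap[OF \<open>i \<noteq> j\<close>, of s] wins_swap[OF \<open>i \<noteq> j\<close>, of t] 1 nz
        by (auto simp: w'_def wins_append wins_rev wins_eq_0 s t cnt
            count_list_replicate T_def algebra_simps split: if_splits)
      moreover have "N\<^sup>2 < 2 * wins i j w" using win 1 ij by auto
      ultimately show ?thesis by (simp add: M_def power2_eq_square algebra_simps)
    next
      case 2
      then have "j \<in> I" "j \<noteq> z" using z by (auto simp: S_def)
      then have "wins i j w' = (N + k) * M"
        using 2 z
        by (auto simp: w'_def wins_append wins_rev wins_eq_0 s t cnt count_list_replicate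
            algebra_simps)
      \<comment> \<open>Strict because 0 < N; in the next case the strictness comes from N <
        2k.\<close>
      moreover have "M * M < (2 * (N + k)) * M" using N by (simp add: M_def)
      ultimately show ?thesis by (simp add: power2_eq_square)
    next
      case 3
      then have "i \<in> I" "i \<noteq> z" "i \<notin> S" using z by (auto simp: T_def)
      then have "wins i j w' = 2 * k * M"
        using 3 z
        by (auto simp: w'_def wins_append wins_rev wins_eq_0 s t cnt_z count_list_replicate)
      moreover have "M * M < (4 * k) * M" using N by (simp add: M_def)
      ultimately show ?thesis by (simp add: power2_eq_square)
    qed
  qed
  ultimately show ?thesis unfolding realizes_def M_def by blast
qed

text \<open>With all copies of \<open>i\<close> after those of \<open>j\<close>, \<open>i\<close>
  wins every pair.\<close>

lemma realizes_two:
  fixes i j :: 'a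
  assumes "i \<noteq> j" "R \<subseteq> {(i, j)}" "0 < N"
  shows "realizes {i, j} R N (replicate N j @ replicate N i)"
  using assms
  by (auto simp: realizes_def wins_append wins_eq_0 count_list_replicate power2_eq_square)

lemma ex_realizes:
  assumes "2 \<le> n" "R \<subseteq> {1..n} \<times> {1..n}" "R \<inter> R\<inverse> = {}"
    and "(odd N \<and> N \<ge> 3 ^ (n - 2)) \<or> (even N \<and> N \<ge> 2 * 3 ^ (n - 2))"
  shows "\<exists>w. realizes {1..n} R N w"
  using assms
proof (induction n arbitrary: R N rule: nat_induct_at_least)
  case base
  have "0 < N" using base by auto
  have I: "{1..2::nat} = {1, 2}" by auto
  have "R \<subseteq> {(1, 2)} \<or> R \<subseteq> {(2, 1)}" using base(1,2) unfolding I by auto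
  then show ?case
    using realizes_two[OF _ _ \<open>0 < N\<close>, of 1 2 R] realizes_two[OF _ _ \<open>0 < N\<close>, of 2 1 R]
    unfolding I by (auto simp: insert_commute)
next
  case (Suc n)
  \<comment> \<open>The least admissible size for \<open>n\<close> vertices with the parity of
    \<open>N\<close>. One more vertex triples this threshold, so 2k = N - N0 is at least 2 * N0,
    hence above \<open>N0\<close>.\<close>
  define N0 :: nat where "N0 = (if odd N then 3 ^ (n - 2) else 2 * 3 ^ (n - 2))"
  define k where "k = (N - N0) div 2"
  have "Suc n - 2 = Suc (n - 2)" using Suc.hyps by simp
  then have "3 * N0 \<le> N" using Suc.prems(3) by (auto simp: N0_def)
  moreover have "even (N - N0)" using calculation by (auto simp: N0_def)
  moreover have "0 < N0" by (simp add: N0_def)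
  ultimately have N: "N = N0 + 2 * k" "N0 < 2 * k" "0 < N0"
    by (auto simp: k_def)
  have I: "{1..Suc n} = insert (Suc n) {1..n}" by auto
  have "\<exists>w. realizes {1..n} (R \<inter> {1..n} \<times> {1..n}) N0 w"
    by (rule Suc.IH) (use Suc.prems(2) in \<open>auto simp: N0_def\<close>)
  then obtain w where "realizes {1..n} (R \<inter> {1..n} \<times> {1..n}) N0 w" ..
  from realizes_insert[OF _ _ _ _ this N(3,2), of "Suc n"] show ?case
    using Suc.prems(1,2) unfolding I N(1)[symmetric] by auto
qed

theorem theorem3p14:
  fixes n N :: nat and R :: "nat rel"
  assumes "n \<ge> 2"
    and "tournament_on {1..n} R"
    and "(odd N \<and> N \<ge> 3 ^ (n - 2)) \<or> (even N \<and> N \<ge> 2 * 3 ^ (n - 2))"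
  shows "\<exists>A. n_partition n N A \<and> partition_digraph n N A = R"
proof -
  have "\<exists>w. realizes {1..n} R N w"
    using ex_realizes assms by (simp add: tournament_on_def digraph_on_def)
  then show ?thesis using realizes_imp_partition assms(2) by blast
qed

end
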